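(* Let $n\ge 2$ and $T\ge 1$ be integers and let $\mu,\rho\in\mathbb{R}$ with $\mu+\rho>0$. For $\gamma\in(0,1)$, $a>0$, $b\in\mathbb{R}$ put $L(a,b)=\max\{|-a\mu+b|,|a\rho+b|\}$ and $$F(\gamma,a,b)=\frac{1}{aT\ln(1/\gamma)}\left(\ln(n)+\frac12\sum_{t=0}^{T-1}\ln^2(1/\gamma)\,L^2(a,b)\right).$$ Let $a^*>0$ be arbitrary and set $$\gamma^*=\exp\left(-\frac{2}{a^*(\mu+\rho)}\sqrt{\frac{2\ln(n)}{T}}\right),\qquad b^*=\frac{\mu-\rho}{2}a^*.$$ Then: (i) $(\gamma^*,a^*,b^* )$ minimizes $F$ over all $\gamma\in(0,1)$, $a>0$, $b\in\mathbb{R}$. (ii) (Optimal Hedge algorithm) For every sequence of loss vectors $\ell_0,\ldots,\ell_{T-1}\in[-\mu,\rho]^n$, the portfolios $x_0,\ldots,x_{T-1}$ generated by the Extended Hedge algorithm with $a=a^*$, $b=b^*$, $\beta_t=1$ and $\lambda_t=\ln(1/\gamma^* )$ for all $t$ satisfy $$\frac1T\max_{x\in\Delta_n}\sum_{t=0}^{T-1}\langle \ell_t,x_t-x\rangle\le\frac{\mu+\rho}{2}\sqrt{\frac{2\ln(n)}{T}}.$$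
   Context: $\Delta_n=\{x\in\mathbb{R}^n: x\ge 0,\ \sum_{i=1}^n x_i=1\}$ is the standard simplex and $\langle\cdot,\cdot\rangle$ is the standard dot product. Extended Hedge algorithm (parameters: positive weights $\lambda_t$, a non-decreasing sequence of positive projection parameters $\beta_t$, $a>0$, $b\in\mathbb{R}$): set $w_0=(1/n,\ldots,1/n)$. For $t=0,\ldots,T-1$: set $x_t=w_t/\sum_{i=1}^n w_{t,i}$, observe the loss vector $\ell_t$, and set $$w_{t+1,i}=\exp\left(-\frac{\lambda_t(a\ell_{t,i}+b)}{\beta_{t+1}}\right)w_{t,i}^{\beta_{t+1}/\beta_t},\qquad i=1,\ldots,n.$$ The loss vectors are arbitrary elements of $[-\mu,\rho]^n$; in particular $\ell_t$ may be chosen depending on the portfolios up to time $t$. *)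

theory Defs
  imports "HOL-Analysis.Analysis"
begin

definition std_prob_simplex :: "(real ^ 'n) set" where
  "std_prob_simplex = {x. (\<forall>i. 0 \<le> x $ i) \<and> (\<Sum>i\<in>UNIV. x $ i) = 1}"

text \<open>The parameters are \<open>lam\<close>, \<open>\<beta>\<close>, \<open>a\<close>, \<open>b\<close> and the loss sequence \<open>l\<close>; the dimension is the
  cardinality of the index type. Weights stay positive, so \<open>powr\<close> is the ordinary real power.\<close>

primrec hedge_weight ::
  "(nat \<Rightarrow> real) \<Rightarrow> (nat \<Rightarrow> real) \<Rightarrow> real \<Rightarrow> real \<Rightarrow> (nat \<Rightarrow> real ^ 'n) \<Rightarrow> nat \<Rightarrow> real ^ 'n"
where
  "hedge_weight lam \<beta> a b l 0 = (\<chi> i. 1 / real CARD('n))"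
| "hedge_weight lam \<beta> a b l (Suc t) =
     (\<chi> i. exp (- (lam t * (a * l t $ i + b) / \<beta> (Suc t)))
            * (hedge_weight lam \<beta> a b l t $ i) powr (\<beta> (Suc t) / \<beta> t))"

definition hedge_portfolio ::
  "(nat \<Rightarrow> real) \<Rightarrow> (nat \<Rightarrow> real) \<Rightarrow> real \<Rightarrow> real \<Rightarrow> (nat \<Rightarrow> real ^ 'n) \<Rightarrow> nat \<Rightarrow> real ^ 'n"
where
  "hedge_portfolio lam \<beta> a b l t =
     (\<chi> i. hedge_weight lam \<beta> a b l t $ i / (\<Sum>j\<in>UNIV. hedge_weight lam \<beta> a b l t $ j))"

definition loss_bound :: "real \<Rightarrow> real \<Rightarrow> real \<Rightarrow> real \<Rightarrow> real" where
  "loss_bound \<mu> \<rho> a b = max \<bar>- a * \<mu> + b\<bar> \<bar>a * \<rho> + b\<bar>"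

definition hedge_bound :: "nat \<Rightarrow> nat \<Rightarrow> real \<Rightarrow> real \<Rightarrow> real \<Rightarrow> real \<Rightarrow> real \<Rightarrow> real" where
  "hedge_bound n T \<mu> \<rho> \<gamma> a b =
     1 / (a * real T * ln (1 / \<gamma>))
       * (ln (real n) + 1 / 2 * (\<Sum>t<T. (ln (1 / \<gamma>))\<^sup>2 * (loss_bound \<mu> \<rho> a b)\<^sup>2))"

definition regret ::
  "nat \<Rightarrow> (nat \<Rightarrow> real ^ 'n) \<Rightarrow> (nat \<Rightarrow> real ^ 'n) \<Rightarrow> real ^ 'n \<Rightarrow> real" where
  "regret T l x y = (\<Sum>t<T. l t \<bullet> (x t - y))"

end

theory Submission
  imports Defs "HOL-Probability.Hoeffding"
begin

text \<open>
  Write \<open>\<eta> = ln (1 / \<gamma>)\<close>, \<open>m = (\<mu> + \<rho>) / 2\<close>, \<open>r = sqrt (2 ln n / T)\<close>, and let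
  \<open>z\<^sub>t = a l\<^sub>t + b\<close> be the rescaled losses, so that \<open>\<bar>z\<^sub>t\<bar> \<le> L = L(a,b)\<close> componentwise.

  The function \<open>F\<close> is an upper bound for the average regret of the algorithm with
  \<^emph>\<open>any\<close> parameters \<open>(\<gamma>, a, b)\<close> (\<open>hedge_average_regret_le\<close>).
  With \<open>\<beta> = 1\<close> the weights are \<open>exp (- \<eta> \<Sum> z\<^sub>s) / n\<close>, and the total weight \<open>W\<^sub>t\<close>
  serves as a potential. On the one hand \<open>W\<^sub>T\<close> dominates each single weight, which costs \<open>ln n\<close>
  against the best coordinate. On the other hand \<open>W\<^bsub>t+1\<^esub> / W\<^sub>t\<close> is the exponential moment of
  \<open>- \<eta> z\<^sub>t\<close> under the distribution \<open>x\<^sub>t\<close>; since \<open>z\<^sub>t\<close> takes values in an interval of length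
  \<open>2 L\<close>, Hoeffding's lemma bounds it by \<open>exp (- \<eta> \<langle>z\<^sub>t, x\<^sub>t\<rangle> + \<eta>\<^sup>2 L\<^sup>2 / 2)\<close>. Comparing logarithms
  gives the bound against every vertex of the simplex, and the regret, being affine in the
  comparison point, is maximal at a vertex.

  It remains to minimise \<open>F\<close>. Since \<open>- a \<mu> + b\<close> and \<open>a \<rho> + b\<close> lie \<open>2 a m\<close> apart, \<open>L \<ge> a m\<close>, with
  equality for the centring shift \<open>b = a (\<mu> - \<rho>) / 2\<close>. For \<open>u = a \<eta>\<close> this gives
  \<open>F \<ge> r\<^sup>2 / (2 u) + u m\<^sup>2 / 2 = r m + (r - u m)\<^sup>2 / (2 u)\<close>. The minimum is therefore \<open>r m\<close>, attained
  when \<open>u = r / m\<close>; only the product \<open>a \<eta>\<close> matters, which is why \<open>a\<close> is arbitrary.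
\<close>


section \<open>Minimising the bound\<close>

lemma loss_bound_ge: "a * (\<mu> + \<rho>) / 2 \<le> loss_bound \<mu> \<rho> a b"
  unfolding loss_bound_def by (auto simp: algebra_simps max_def abs_if)

lemma loss_bound_centred:
  assumes "a * (\<mu> + \<rho>) \<ge> 0"
  shows "loss_bound \<mu> \<rho> a ((\<mu> - \<rho>) / 2 * a) = a * (\<mu> + \<rho>) / 2"
proof -
  have "- a * \<mu> + (\<mu> - \<rho>) / 2 * a = - (a * (\<mu> + \<rho>) / 2)"
    "a * \<rho> + (\<mu> - \<rho>) / 2 * a = a * (\<mu> + \<rho>) / 2"
    by (simp_all add: field_simps)
  then show ?thesis
    unfolding loss_bound_def using assms by simp
qed

lemma abs_le_loss_bound:
  assumes "a \<ge> 0" "v \<in> {- \<mu>..\<rho>}"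
  shows "\<bar>a * v + b\<bar> \<le> loss_bound \<mu> \<rho> a b"
proof -
  have "a * (- \<mu>) \<le> a * v" "a * v \<le> a * \<rho>"
    using assms mult_left_mono[of "- \<mu>" v a] mult_left_mono[of v \<rho> a] by auto
  then show ?thesis
    unfolding loss_bound_def by (auto simp: max_def abs_if)
qed

text \<open>The form of the bound to which completing the square applies.\<close>

lemma hedge_bound_eq:
  assumes "T \<ge> 1" "a \<noteq> 0" "ln (1 / \<gamma>) \<noteq> 0" "n \<ge> 1"
  shows "hedge_bound n T \<mu> \<rho> \<gamma> a b =
    (sqrt (2 * ln (real n) / real T))\<^sup>2 / (2 * (a * ln (1 / \<gamma>)))
      + a * ln (1 / \<gamma>) * (loss_bound \<mu> \<rho> a b / a)\<^sup>2 / 2"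
proof -
  have "(sqrt (2 * ln (real n) / real T))\<^sup>2 = 2 * ln (real n) / real T"
    using assms by simp
  moreover define \<eta> L where "\<eta> = ln (1 / \<gamma>)" and "L = loss_bound \<mu> \<rho> a b"
  ultimately show ?thesis
    using assms unfolding hedge_bound_def \<eta>_def[symmetric] L_def[symmetric]
    by (simp add: field_simps power2_eq_square)
qed

lemma complete_square:
  fixes u r m :: real
  assumes "u \<noteq> 0"
  shows "r\<^sup>2 / (2 * u) + u * m\<^sup>2 / 2 = m * r + (r - u * m)\<^sup>2 / (2 * u)"
  using assms by (simp add: field_simps power2_eq_square)

lemma hedge_bound_ge:
  assumes "T \<ge> 1" "n \<ge> 1" "\<mu> + \<rho> \<ge> 0" "0 < \<gamma>" "\<gamma> < 1" "0 < a"
  shows "(\<mu> + \<rho>) / 2 * sqrt (2 * ln (real n) / real T) \<le> hedge_bound n T \<mu> \<rho> \<gamma> a b"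
proof -
  define u r m where "u = a * ln (1 / \<gamma>)" and "r = sqrt (2 * ln (real n) / real T)"
    and "m = (\<mu> + \<rho>) / 2"
  have pos: "ln (1 / \<gamma>) > 0"
    using assms by simp
  then have u: "u > 0"
    using assms by (simp add: u_def)
  have m: "m \<le> loss_bound \<mu> \<rho> a b / a"
    using loss_bound_ge[of a \<mu> \<rho> b] assms by (simp add: m_def field_simps)
  have "m * r \<le> r\<^sup>2 / (2 * u) + u * m\<^sup>2 / 2"
    using u by (simp add: complete_square)
  also have "\<dots> \<le> r\<^sup>2 / (2 * u) + u * (loss_bound \<mu> \<rho> a b / a)\<^sup>2 / 2"
    using u m assms by (intro add_left_mono divide_right_mono mult_left_mono power_mono)
      (auto simp: m_def)
  also have "\<dots> = hedge_bound n T \<mu> \<rho> \<gamma> a b"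
    using hedge_bound_eq[of T a \<gamma> n \<mu> \<rho> b] assms pos by (simp add: u_def r_def)
  finally show ?thesis
    by (simp add: m_def r_def)
qed

lemma hedge_bound_optimal:
  assumes "T \<ge> 1" "n \<ge> 2" "\<mu> + \<rho> > 0" "0 < a"
    and \<gamma>: "\<gamma> = exp (- (2 / (a * (\<mu> + \<rho>)) * sqrt (2 * ln (real n) / real T)))"
  shows "hedge_bound n T \<mu> \<rho> \<gamma> a ((\<mu> - \<rho>) / 2 * a)
    = (\<mu> + \<rho>) / 2 * sqrt (2 * ln (real n) / real T)"
proof -
  define u r m where "u = a * ln (1 / \<gamma>)" and "r = sqrt (2 * ln (real n) / real T)"
    and "m = (\<mu> + \<rho>) / 2"
  have r: "r > 0"
    using assms by (simp add: r_def)
  have m: "m > 0" "\<mu> + \<rho> = 2 * m"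
    using assms by (simp_all add: m_def)
  have "ln (1 / \<gamma>) = 2 / (a * (\<mu> + \<rho>)) * r"
    by (simp add: \<gamma> r_def ln_div)
  then have "u = r / m"
    using m \<open>0 < a\<close> by (simp add: u_def)
  then have um: "u * m = r" "u > 0"
    using r m by simp_all
  have "hedge_bound n T \<mu> \<rho> \<gamma> a ((\<mu> - \<rho>) / 2 * a)
      = r\<^sup>2 / (2 * u) + u * (loss_bound \<mu> \<rho> a ((\<mu> - \<rho>) / 2 * a) / a)\<^sup>2 / 2"
    using hedge_bound_eq[of T a \<gamma> n \<mu> \<rho>] assms um(2) by (auto simp: u_def r_def)
  also have "loss_bound \<mu> \<rho> a ((\<mu> - \<rho>) / 2 * a) / a = m"
    using loss_bound_centred[of a \<mu> \<rho>] assms by (simp add: m_def)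
  also have "r\<^sup>2 / (2 * u) + u * m\<^sup>2 / 2 = m * r"
    using um by (simp add: complete_square)
  finally show ?thesis
    by (simp add: m_def r_def)
qed


section \<open>Exponential moments\<close>

text \<open>Hoeffding's lemma for the finite distribution \<open>p\<close> and the variable \<open>- z\<close>, whose range
  \<open>[- L, L]\<close> has length \<open>2 L\<close>; this turns the usual constant \<open>1 / 8\<close> into \<open>1 / 2\<close>.\<close>

lemma hoeffding_lemma_finite:
  fixes p z :: "'n::finite \<Rightarrow> real"
  assumes p: "\<And>i. p i \<ge> 0" "(\<Sum>i\<in>UNIV. p i) = 1"
    and z: "\<And>i. \<bar>z i\<bar> \<le> L" and s: "s > 0"
  shows "(\<Sum>i\<in>UNIV. p i * exp (- (s * z i))) \<le> exp (- (s * (\<Sum>i\<in>UNIV. p i * z i)) + s\<^sup>2 * L\<^sup>2 / 2)"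
proof -
  define M where "M = point_measure UNIV p"
  define e where "e = (\<Sum>i\<in>UNIV. p i * z i)"
  have "emeasure M (space M) = 1"
    using p by (simp add: M_def space_point_measure emeasure_point_measure_finite sum_ennreal
        del: ennreal_1 flip: ennreal_1)
  then interpret prob_space M
    by (rule prob_spaceI)
  interpret interval_bounded_random_variable M "\<lambda>i. - z i" "- L" L
  proof
    show "(\<lambda>i. - z i) \<in> borel_measurable M"
      by (simp add: M_def measurable_point_measure_eq1)
    show "AE i in M. - z i \<in> {- L..L}"
      using z by (intro AE_I2) (auto simp: abs_le_iff minus_le_iff)
  qed
  have e: "expectation (\<lambda>i. - z i) = - e"
    using p by (simp add: M_def lebesgue_integral_point_measure_finite e_def sum_negf)
  have "(\<integral>\<^sup>+ i. exp (s * (- z i - expectation (\<lambda>i. - z i))) \<partial>M) \<le> ennreal (exp (s\<^sup>2 * (L - - L)\<^sup>2 / 8))"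
    by (rule Hoeffdings_lemma_nn_integral[OF s])
  also have "(\<integral>\<^sup>+ i. exp (s * (- z i - expectation (\<lambda>i. - z i))) \<partial>M)
      = ennreal (\<Sum>i\<in>UNIV. p i * exp (s * (e - z i)))"
    unfolding e using p
    by (simp add: M_def nn_integral_point_measure_finite sum_ennreal flip: ennreal_mult)
  finally have "(\<Sum>i\<in>UNIV. p i * exp (s * (e - z i))) \<le> exp (s\<^sup>2 * (L - - L)\<^sup>2 / 8)"
    by simp
  also have "s\<^sup>2 * (L - - L)\<^sup>2 / 8 = s\<^sup>2 * L\<^sup>2 / 2"
    by (simp add: power2_eq_square)
  also have "(\<Sum>i\<in>UNIV. p i * exp (s * (e - z i)))
      = exp (s * e) * (\<Sum>i\<in>UNIV. p i * exp (- (s * z i)))"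
    by (simp add: sum_distrib_left right_diff_distrib exp_diff exp_minus field_simps)
  finally have "exp (- (s * e)) * (exp (s * e) * (\<Sum>i\<in>UNIV. p i * exp (- (s * z i))))
      \<le> exp (- (s * e)) * exp (s\<^sup>2 * L\<^sup>2 / 2)"
    by (intro mult_left_mono) auto
  then show ?thesis
    by (simp add: e_def[symmetric] mult.assoc[symmetric] flip: exp_add)
qed


section \<open>Regret of the Hedge algorithm\<close>

lemma hedge_weight_const:
  fixes l :: "nat \<Rightarrow> real ^ 'n"
  shows "hedge_weight (\<lambda>t. \<eta>) (\<lambda>t. 1) a b l t $ i
    = exp (- (\<eta> * (\<Sum>s<t. a * l s $ i + b))) / real CARD('n)"
proof (induction t)
  case (Suc t)
  then show ?case
    by (simp add: distrib_left exp_add[symmetric])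
qed simp

lemma hedge_portfolio_in_simplex:
  fixes l :: "nat \<Rightarrow> real ^ 'n"
  shows "hedge_portfolio (\<lambda>t. \<eta>) (\<lambda>t. 1) a b l t \<in> std_prob_simplex"
proof -
  define w where "w = hedge_weight (\<lambda>t. \<eta>) (\<lambda>t. 1) a b l t"
  have "w $ i > 0" for i
    by (simp add: w_def hedge_weight_const)
  then have "(\<Sum>j\<in>UNIV. w $ j) > 0" and "w $ i \<ge> 0" for i
    by (auto intro!: sum_pos less_imp_le)
  then show ?thesis
    by (auto simp: std_prob_simplex_def hedge_portfolio_def w_def[symmetric]
        intro!: divide_nonneg_pos simp flip: sum_divide_distrib)
qed

text \<open>The potential argument: one step multiplies the total weight by the exponential moment of the
  current losses under the current portfolio.\<close>

lemma total_weight_le: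
  fixes l :: "nat \<Rightarrow> real ^ 'n" and \<eta> a b L :: real
  defines "w \<equiv> hedge_weight (\<lambda>t. \<eta>) (\<lambda>t. 1) a b l"
    and "x \<equiv> hedge_portfolio (\<lambda>t. \<eta>) (\<lambda>t. 1) a b l"
  assumes \<eta>: "\<eta> > 0" and L: "\<And>t i. t < T \<Longrightarrow> \<bar>a * l t $ i + b\<bar> \<le> L"
  shows "t \<le> T \<Longrightarrow> (\<Sum>i\<in>UNIV. w t $ i)
    \<le> exp (\<Sum>s<t. - (\<eta> * (a * (l s \<bullet> x s) + b)) + \<eta>\<^sup>2 * L\<^sup>2 / 2)"
proof (induction t)
  case 0
  then show ?case
    by (simp add: w_def)
next
  case (Suc t)
  have x: "x t $ i \<ge> 0" "(\<Sum>i\<in>UNIV. x t $ i) = 1" for i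
    using hedge_portfolio_in_simplex[of \<eta> a b l t] by (auto simp: x_def std_prob_simplex_def)
  define W where "W = (\<Sum>i\<in>UNIV. w t $ i)"
  have w: "w t $ i > 0" for i
    by (simp add: w_def hedge_weight_const)
  then have W: "W > 0"
    by (auto simp: W_def intro!: sum_pos)
  have xw: "w t $ i = W * x t $ i" for i
    using W by (simp add: x_def hedge_portfolio_def w_def[symmetric] W_def[symmetric])
  have w_Suc: "w (Suc t) $ i = W * (x t $ i * exp (- (\<eta> * (a * l t $ i + b))))" for i
    using w[of i] xw[of i] by (simp add: w_def)
  have mean: "(\<Sum>i\<in>UNIV. x t $ i * (a * l t $ i + b)) = a * (l t \<bullet> x t) + b"
  proof -
    have "(\<Sum>i\<in>UNIV. x t $ i * (a * l t $ i + b)) = a * (l t \<bullet> x t) + b * (\<Sum>i\<in>UNIV. x t $ i)"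
      by (simp add: inner_vec_def distrib_left sum.distrib sum_distrib_left mult_ac)
    then show ?thesis
      using x(2) by simp
  qed
  have "(\<Sum>i\<in>UNIV. w (Suc t) $ i) = W * (\<Sum>i\<in>UNIV. x t $ i * exp (- (\<eta> * (a * l t $ i + b))))"
    by (simp add: w_Suc sum_distrib_left)
  also have "\<dots> \<le> W * exp (- (\<eta> * (a * (l t \<bullet> x t) + b)) + \<eta>\<^sup>2 * L\<^sup>2 / 2)"
    using hoeffding_lemma_finite[of "\<lambda>i. x t $ i" "\<lambda>i. a * l t $ i + b" L \<eta>] x L[of t] Suc.prems \<eta> W
    by (intro mult_left_mono) (simp_all add: mean)
  also have "\<dots> \<le> exp (\<Sum>s<t. - (\<eta> * (a * (l s \<bullet> x s) + b)) + \<eta>\<^sup>2 * L\<^sup>2 / 2)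
      * exp (- (\<eta> * (a * (l t \<bullet> x t) + b)) + \<eta>\<^sup>2 * L\<^sup>2 / 2)"
    using Suc by (intro mult_right_mono) (simp_all add: W_def)
  finally show ?case
    by (simp add: exp_add)
qed

lemma hedge_average_regret_le:
  fixes l :: "nat \<Rightarrow> real ^ 'n" and k :: 'n
  assumes T: "T \<ge> 1" and \<gamma>: "0 < \<gamma>" "\<gamma> < 1" and a: "a > 0"
    and l: "\<And>t i. t < T \<Longrightarrow> l t $ i \<in> {- \<mu>..\<rho>}"
  shows "1 / real T * regret T l (hedge_portfolio (\<lambda>t. ln (1 / \<gamma>)) (\<lambda>t. 1) a b l) (axis k 1)
    \<le> hedge_bound CARD('n) T \<mu> \<rho> \<gamma> a b"
proof -
  define \<eta> where "\<eta> = ln (1 / \<gamma>)"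
  define L where "L = loss_bound \<mu> \<rho> a b"
  define x where "x = hedge_portfolio (\<lambda>t. \<eta>) (\<lambda>t. 1) a b l"
  define w where "w = hedge_weight (\<lambda>t. \<eta>) (\<lambda>t. 1) a b l"
  have \<eta>: "\<eta> > 0"
    using \<gamma> by (simp add: \<eta>_def)
  have "exp (- (\<eta> * (\<Sum>s<T. a * l s $ k + b)) - ln (real CARD('n))) = w T $ k"
    by (simp add: w_def hedge_weight_const exp_diff)
  also have "\<dots> \<le> (\<Sum>i\<in>UNIV. w T $ i)"
    by (rule member_le_sum) (auto simp: w_def hedge_weight_const)
  also have "\<dots> \<le> exp (\<Sum>s<T. - (\<eta> * (a * (l s \<bullet> x s) + b)) + \<eta>\<^sup>2 * L\<^sup>2 / 2)"
    unfolding w_def x_def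
    by (rule total_weight_le[OF \<eta> _ order_refl]) (use l a in \<open>auto simp: L_def intro!: abs_le_loss_bound\<close>)
  finally have "\<eta> * (\<Sum>s<T. a * (l s \<bullet> x s) + b) - \<eta> * (\<Sum>s<T. a * l s $ k + b)
      \<le> ln (real CARD('n)) + 1 / 2 * (\<Sum>s<T. \<eta>\<^sup>2 * L\<^sup>2)"
    by (simp add: sum.distrib sum_negf sum_subtractf flip: sum_distrib_left)
  also have "\<eta> * (\<Sum>s<T. a * (l s \<bullet> x s) + b) - \<eta> * (\<Sum>s<T. a * l s $ k + b)
      = a * \<eta> * regret T l x (axis k 1)"
    by (simp add: regret_def inner_diff_right inner_axis sum.distrib sum_subtractf
        sum_distrib_left algebra_simps)
  finally have "1 / (a * real T * \<eta>) * (a * \<eta> * regret T l x (axis k 1))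
      \<le> 1 / (a * real T * \<eta>) * (ln (real CARD('n)) + 1 / 2 * (\<Sum>s<T. \<eta>\<^sup>2 * L\<^sup>2))"
    using a \<eta> by (intro mult_left_mono) auto
  moreover have "1 / (a * real T * \<eta>) * (a * \<eta> * regret T l x (axis k 1))
      = 1 / real T * regret T l x (axis k 1)"
    using a \<eta> by simp
  ultimately show ?thesis
    by (simp only: hedge_bound_def x_def \<eta>_def L_def)
qed

text \<open>The comparison point enters the regret only through a linear functional, which over the
  simplex is extremal at the vertex of smallest cumulative loss.\<close>

lemma regret_arg_max_vertex:
  fixes l x :: "nat \<Rightarrow> real ^ 'n"
  obtains k where "is_arg_max (regret T l x) (\<lambda>y. y \<in> std_prob_simplex) (axis k 1)"
proof -
  define C where "C = (\<lambda>i. \<Sum>t<T. l t $ i)"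
  define k where "k = arg_min_on C UNIV"
  have k: "C k \<le> C i" for i
    unfolding k_def by (rule arg_min_least) auto
  have regret: "regret T l x y = (\<Sum>t<T. l t \<bullet> x t) - (\<Sum>i\<in>UNIV. C i * y $ i)" for y
  proof -
    have "(\<Sum>t<T. l t \<bullet> y) = (\<Sum>i\<in>UNIV. C i * y $ i)"
      unfolding inner_vec_def C_def sum_distrib_right by (subst sum.swap) simp
    then show ?thesis
      by (simp add: regret_def inner_diff_right sum_subtractf)
  qed
  have axis: "(\<Sum>i\<in>UNIV. C i * axis k 1 $ i) = C k"
    by (simp add: axis_def if_distrib cong: if_cong)
  have "regret T l x y \<le> regret T l x (axis k 1)" if y: "y \<in> std_prob_simplex" for y
  proof -
    have "C k = (\<Sum>i\<in>UNIV. C k * y $ i)"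
      using y by (simp add: std_prob_simplex_def flip: sum_distrib_left)
    also have "\<dots> \<le> (\<Sum>i\<in>UNIV. C i * y $ i)"
      using y k by (intro sum_mono mult_right_mono) (auto simp: std_prob_simplex_def)
    finally show ?thesis
      by (simp add: regret axis)
  qed
  moreover have "axis k 1 \<in> std_prob_simplex"
    by (auto simp: std_prob_simplex_def axis_def)
  ultimately show thesis
    using that[of k] by (auto simp: is_arg_max_def not_less)
qed

theorem mainTheorem2:
  fixes T :: nat and \<mu> \<rho> a' b' \<gamma>' :: real
  assumes n: "CARD('n::finite) \<ge> 2"
    and T: "T \<ge> 1"
    and range: "\<mu> + \<rho> > 0"
    and a': "a' > 0"
    and \<gamma>': "\<gamma>' = exp (- (2 / (a' * (\<mu> + \<rho>)) * sqrt (2 * ln (real CARD('n)) / real T)))"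
    and b': "b' = (\<mu> - \<rho>) / 2 * a'"
  shows "is_arg_min (\<lambda>(\<gamma>, a, b). hedge_bound CARD('n) T \<mu> \<rho> \<gamma> a b)
           (\<lambda>(\<gamma>, a, b). 0 < \<gamma> \<and> \<gamma> < 1 \<and> 0 < a) (\<gamma>', a', b')
    \<and> (\<forall>l :: nat \<Rightarrow> real ^ 'n. (\<forall>t<T. \<forall>i. l t $ i \<in> {- \<mu>..\<rho>}) \<longrightarrow>
         (let x = hedge_portfolio (\<lambda>t. ln (1 / \<gamma>')) (\<lambda>t. 1) a' b' l
          in \<exists>y. is_arg_max (regret T l x) (\<lambda>y. y \<in> std_prob_simplex) y \<and>
               1 / real T * regret T l x y
                 \<le> (\<mu> + \<rho>) / 2 * sqrt (2 * ln (real CARD('n)) / real T)))"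
proof -
  have "ln (real CARD('n)) > 0"
    using n by simp
  then have \<gamma>01: "0 < \<gamma>'" "\<gamma>' < 1"
    using T range a' by (auto simp: \<gamma>')
  have opt: "hedge_bound CARD('n) T \<mu> \<rho> \<gamma>' a' b'
      = (\<mu> + \<rho>) / 2 * sqrt (2 * ln (real CARD('n)) / real T)"
    unfolding b' by (rule hedge_bound_optimal[OF T n range a' \<gamma>'])
  have "is_arg_min (\<lambda>(\<gamma>, a, b). hedge_bound CARD('n) T \<mu> \<rho> \<gamma> a b)
      (\<lambda>(\<gamma>, a, b). 0 < \<gamma> \<and> \<gamma> < 1 \<and> 0 < a) (\<gamma>', a', b')"
    using hedge_bound_ge[of T "CARD('n)" \<mu> \<rho>] T n range \<gamma>01 a'
    by (auto simp: is_arg_min_def opt not_less)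
  moreover have "\<exists>y. is_arg_max (regret T l x) (\<lambda>y. y \<in> std_prob_simplex) y \<and>
      1 / real T * regret T l x y \<le> (\<mu> + \<rho>) / 2 * sqrt (2 * ln (real CARD('n)) / real T)"
    if l: "\<forall>t<T. \<forall>i. l t $ i \<in> {- \<mu>..\<rho>}"
      and x: "x = hedge_portfolio (\<lambda>t. ln (1 / \<gamma>')) (\<lambda>t. 1) a' b' l"
    for l x :: "nat \<Rightarrow> real ^ 'n"
  proof -
    obtain k where "is_arg_max (regret T l x) (\<lambda>y. y \<in> std_prob_simplex) (axis k 1)"
      by (rule regret_arg_max_vertex)
    moreover have "1 / real T * regret T l x (axis k 1) \<le> hedge_bound CARD('n) T \<mu> \<rho> \<gamma>' a' b'"
      unfolding x using T \<gamma>01 a' l by (intro hedge_average_regret_le) auto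
    ultimately show ?thesis
      unfolding opt by blast
  qed
  ultimately show ?thesis
    unfolding Let_def by blast
qed

end
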